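(* Let $\mathfrak g_1$ and $\mathfrak g_2$ be finite-dimensional Lie algebras over $\mathbb R$ or $\mathbb C$ with $\mathfrak g_2$ abelian, let $\psi\colon\mathfrak g_1\to\mathrm{Der}(\mathfrak g_2)$ be a Lie algebra homomorphism, let $\mathfrak g=\mathfrak g_1\ltimes_\psi\mathfrak g_2$, and let $\pi_1\colon\mathfrak g\to\mathfrak g_1$ be the natural projection. Consider the map $\Gamma$ that assigns to each Lie subalgebra $\mathfrak h\subset\mathfrak g$ the triple $(\mathfrak h_1,U,\alpha)$ with $$\mathfrak h_1=\pi_1(\mathfrak h),\quad U=\mathfrak h\cap\mathfrak g_2,\quad \alpha\colon\mathfrak h_1\ni x\longmapsto\{v\in\mathfrak g_2\mid(x,v)\in\mathfrak h\}\in\mathfrak g_2/U.$$ Then $\Gamma$ is a well-defined map from the set of Lie subalgebras of $\mathfrak g$ to the set of triples $(\mathfrak h_1,U,\alpha)$ in which $\mathfrak h_1\subset\mathfrak g_1$ is a Lie subalgebra, $U\subset\mathfrak g_2$ is an $\mathfrak h_1$-submodule and $\alpha\colon\mathfrak h_1\to\mathfrak g_2/U$ is a $1$-cocycle, i.e., a linear map satisfying $$\alpha([x,y])=\psi(x)\alpha(y)-\psi(y)\alpha(x)\quad\text{for all }x,y\in\mathfrak h_1.$$ Moreover, $\Gamma$ has an inverse, which maps such a triple to the Lie subalgebra of $\mathfrak g$ given by $$\Gamma^{-1}\colon(\mathfrak h_1,U,\alpha)\longmapsto\mathfrak h:=\{(x,v)\mid x\in\mathfrak h_1,\ v\in\a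lpha(x)\}.$$
   Context: The bracket on $\mathfrak g=\mathfrak g_1\ltimes_\psi\mathfrak g_2$ (with $\mathfrak g_2$ abelian) is $[(x_1,v_1),(x_2,v_2)]=([x_1,x_2],\psi(x_1)v_2-\psi(x_2)v_1)$. $\mathfrak g_2$ is identified with $\{0\}\times\mathfrak g_2$. The $\mathfrak h_1$-module structure on $\mathfrak g_2$ is $x\cdot v=\psi(x)v$, and $\psi(x)$ also denotes the induced map on $\mathfrak g_2/U$. Elements of $\mathfrak g_2/U$ are regarded as cosets, i.e. subsets of $\mathfrak g_2$. *)

theory Defs
  imports
    "HOL-Analysis.Product_Vector"
    "HOL-Library.Set_Algebras"
    "HOL-Library.FuncSet"
begin

section \<open>Lie algebras\<close>

locale lie_algebra = vector_space scale
  for scale :: "'k::field \<Rightarrow> 'a::ab_group_add \<Rightarrow> 'a" +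
  fixes bracket :: "'a \<Rightarrow> 'a \<Rightarrow> 'a"
  assumes linear_bracket_right: "Vector_Spaces.linear scale scale (\<lambda>y. bracket x y)"
    and linear_bracket_left: "Vector_Spaces.linear scale scale (\<lambda>x. bracket x y)"
    and bracket_self: "bracket x x = 0"
    and jacobi: "bracket x (bracket y z) + bracket y (bracket z x) + bracket z (bracket x y) = 0"

text \<open>To treat base fields \<open>\<real>\<close> and \<open>\<complex>\<close> at once, use scalars in class \<^class>\<open>real_normed_field\<close>:
  by the Gelfand--Mazur theorem these are, up to isomorphism, its only instances.\<close>

definition abelian_bracket :: "('a \<Rightarrow> 'a \<Rightarrow> 'a::zero) \<Rightarrow> bool" where
  "abelian_bracket br \<longleftrightarrow> (\<forall>x y. br x y = 0)"

definition lie_subalgebras ::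
    "('k::field \<Rightarrow> 'a::ab_group_add \<Rightarrow> 'a) \<Rightarrow> ('a \<Rightarrow> 'a \<Rightarrow> 'a) \<Rightarrow> 'a set set" where
  "lie_subalgebras s br = {H. module.subspace s H \<and> (\<forall>x\<in>H. \<forall>y\<in>H. br x y \<in> H)}"

definition derivations ::
    "('k::field \<Rightarrow> 'a::ab_group_add \<Rightarrow> 'a) \<Rightarrow> ('a \<Rightarrow> 'a \<Rightarrow> 'a) \<Rightarrow> ('a \<Rightarrow> 'a) set" where
  "derivations s br =
     {D. Vector_Spaces.linear s s D \<and> (\<forall>x y. D (br x y) = br (D x) y + br x (D y))}"

text \<open>The Lie algebra structure on derivations is pointwise, with the commutator as bracket.\<close>

definition lie_hom_to_derivations ::
    "('k::field \<Rightarrow> 'a::ab_group_add \<Rightarrow> 'a) \<Rightarrow> ('a \<Rightarrow> 'a \<Rightarrow> 'a) \<Rightarrow>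
     ('k \<Rightarrow> 'b::ab_group_add \<Rightarrow> 'b) \<Rightarrow> ('b \<Rightarrow> 'b \<Rightarrow> 'b) \<Rightarrow> ('a \<Rightarrow> 'b \<Rightarrow> 'b) \<Rightarrow> bool" where
  "lie_hom_to_derivations s1 br1 s2 br2 \<psi> \<longleftrightarrow>
     (\<forall>x. \<psi> x \<in> derivations s2 br2) \<and>
     (\<forall>x y. \<psi> (x + y) = (\<lambda>v. \<psi> x v + \<psi> y v)) \<and>
     (\<forall>c x. \<psi> (s1 c x) = (\<lambda>v. s2 c (\<psi> x v))) \<and>
     (\<forall>x y. \<psi> (br1 x y) = (\<lambda>v. \<psi> x (\<psi> y v) - \<psi> y (\<psi> x v)))"

text \<open>The bracket of the semidirect product for an abelian second factor; the underlying vector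
  space is the product type with \<^term>\<open>module_prod.scale s1 s2\<close>.\<close>

definition semidirect_bracket ::
    "('a \<Rightarrow> 'a \<Rightarrow> 'a) \<Rightarrow> ('a \<Rightarrow> 'b \<Rightarrow> 'b) \<Rightarrow> 'a \<times> 'b \<Rightarrow> 'a \<times> 'b \<Rightarrow> 'a \<times> 'b::ab_group_add" where
  "semidirect_bracket br1 \<psi> p q =
     (br1 (fst p) (fst q), \<psi> (fst p) (snd q) - \<psi> (fst q) (snd p))"

lemma lie_algebra_semidirect:
  assumes L1: "lie_algebra s1 br1" and L2: "lie_algebra s2 br2"
    and \<psi>: "lie_hom_to_derivations s1 br1 s2 br2 \<psi>"
  shows "lie_algebra (module_prod.scale s1 s2) (semidirect_bracket br1 \<psi>)"
proof -
  interpret L1: lie_algebra s1 br1 by fact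
  interpret L2: lie_algebra s2 br2 by fact
  interpret P: vector_space_prod s1 s2 by unfold_locales
  have hom: "module_hom s2 s2 (\<psi> x)" for x
    using \<psi> by (simp add: lie_hom_to_derivations_def derivations_def module_hom_iff_linear)
  have ops: "\<psi> (x + y) v = \<psi> x v + \<psi> y v" "\<psi> (s1 c x) v = s2 c (\<psi> x v)"
      "\<psi> (br1 x y) v = \<psi> x (\<psi> y v) - \<psi> y (\<psi> x v)"
      "\<psi> x (v + w) = \<psi> x v + \<psi> x w" "\<psi> x (s2 c v) = s2 c (\<psi> x v)"
      "\<psi> x (v - w) = \<psi> x v - \<psi> x w" for c x y v w
    using \<psi> module_hom.add[OF hom] module_hom.scale[OF hom] module_hom.diff[OF hom]
    by (simp_all add: lie_hom_to_derivations_def)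
  have br: "br1 (x + x') y = br1 x y + br1 x' y" "br1 (s1 c x) y = s1 c (br1 x y)"
      "br1 y (x + x') = br1 y x + br1 y x'" "br1 y (s1 c x) = s1 c (br1 y x)" for c x x' y
    using L1.linear_bracket_left L1.linear_bracket_right
    by (simp_all add: Vector_Spaces.linear_iff)
  show ?thesis
    by unfold_locales
      (auto simp: semidirect_bracket_def P.scale_def ops br prod_eq_iff L1.bracket_self L1.jacobi L1.jacobi[unfolded add.assoc]
        L2.scale_right_diff_distrib algebra_simps)
qed


section \<open>Quotient spaces\<close>

definition cosets :: "'b::ab_group_add set \<Rightarrow> 'b set set" where
  "cosets U = range (\<lambda>v. v +o U)"

text \<open>The map induced on cosets of \<open>U\<close> by an additive map \<open>f\<close> preserving \<open>U\<close>. Adding \<open>U\<close> matters when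
  \<open>f\<close> is not onto, e.g. for scalar multiplication by zero. The sum in the quotient is
  the elementwise sum \<open>+\<close> of sets; as \<open>-\<close> on sets is set difference, the difference
  in the quotient needs its own name.\<close>

definition coset_map :: "'b::ab_group_add set \<Rightarrow> ('b \<Rightarrow> 'b) \<Rightarrow> 'b set \<Rightarrow> 'b set" where
  "coset_map U f A = f ` A + U"

definition coset_diff :: "'b::ab_group_add set \<Rightarrow> 'b set \<Rightarrow> 'b set" where
  "coset_diff A B = {a - b | a b. a \<in> A \<and> b \<in> B}"

lemma (in module) coset_plus_coset:
  assumes "subspace U"
  shows "(v +o U) + (w +o U) = (v + w) +o U"
proof -
  have "U + U = U"
    using assms subspace_0[OF assms] by (force simp: set_plus_def subspace_add)
  then show ?thesis
    by (simp add: set_plus_rearrange)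
qed

lemma (in module) coset_map_coset:
  assumes "subspace U" and "\<And>x y. f (x + y) = f x + f y" and "f ` U \<subseteq> U"
  shows "coset_map U f (v +o U) = f v +o U"
proof -
  have "f 0 = 0"
    using assms(2)[of 0 0] by simp
  show ?thesis
  proof safe
    fix z assume "z \<in> coset_map U f (v +o U)"
    then obtain a b where "a \<in> U" "b \<in> U" "z = f v + (f a + b)"
      by (auto simp: coset_map_def set_plus_def elt_set_plus_def assms(2) add.assoc)
    then show "z \<in> f v +o U"
      using assms(1,3) by (auto simp: elt_set_plus_def intro!: subspace_add)
  next
    fix z assume "z \<in> f v +o U"
    then obtain b where "b \<in> U" "z = f (v + 0) + b"
      by (auto simp: elt_set_plus_def)
    then show "z \<in> coset_map U f (v +o U)"
      using subspace_0[OF assms(1)]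
      unfolding coset_map_def set_plus_def elt_set_plus_def by blast
  qed
qed

lemma (in module) coset_diff_coset:
  assumes "subspace U"
  shows "coset_diff (v +o U) (w +o U) = (v - w) +o U"
proof safe
  fix z assume "z \<in> coset_diff (v +o U) (w +o U)"
  then obtain a b where "a \<in> U" "b \<in> U" "z = (v - w) + (a - b)"
    by (auto simp: coset_diff_def elt_set_plus_def algebra_simps)
  then show "z \<in> (v - w) +o U"
    using assms by (auto simp: elt_set_plus_def intro!: subspace_diff)
next
  fix z assume "z \<in> (v - w) +o U"
  then obtain a where "a \<in> U" "z = (v + a) - (w + 0)"
    by (auto simp: elt_set_plus_def algebra_simps)
  then show "z \<in> coset_diff (v +o U) (w +o U)"
    using subspace_0[OF assms] unfolding coset_diff_def elt_set_plus_def by blast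
qed


section \<open>Submodules, cocycles, and the correspondence\<close>

definition submodules ::
    "('k::field \<Rightarrow> 'b::ab_group_add \<Rightarrow> 'b) \<Rightarrow> ('a \<Rightarrow> 'b \<Rightarrow> 'b) \<Rightarrow> 'a set \<Rightarrow> 'b set set" where
  "submodules s2 \<psi> h1 = {U. module.subspace s2 U \<and> (\<forall>x\<in>h1. \<forall>u\<in>U. \<psi> x u \<in> U)}"

text \<open>Maps with domain \<open>h1\<close> are represented by functions that are \<^term>\<open>undefined\<close>
  outside \<open>h1\<close>, so that equality of functions is equality of maps on \<open>h1\<close>.\<close>

definition one_cocycles ::
    "('k::field \<Rightarrow> 'a::ab_group_add \<Rightarrow> 'a) \<Rightarrow> ('a \<Rightarrow> 'a \<Rightarrow> 'a) \<Rightarrow>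
     ('k \<Rightarrow> 'b::ab_group_add \<Rightarrow> 'b) \<Rightarrow> ('a \<Rightarrow> 'b \<Rightarrow> 'b) \<Rightarrow> 'a set \<Rightarrow> 'b set \<Rightarrow> ('a \<Rightarrow> 'b set) set" where
  "one_cocycles s1 br1 s2 \<psi> h1 U =
     {\<alpha> \<in> h1 \<rightarrow>\<^sub>E cosets U.
        (\<forall>x\<in>h1. \<forall>y\<in>h1. \<alpha> (x + y) = \<alpha> x + \<alpha> y) \<and>
        (\<forall>c. \<forall>x\<in>h1. \<alpha> (s1 c x) = coset_map U (s2 c) (\<alpha> x)) \<and>
        (\<forall>x\<in>h1. \<forall>y\<in>h1. \<alpha> (br1 x y) =
           coset_diff (coset_map U (\<psi> x) (\<alpha> y)) (coset_map U (\<psi> y) (\<alpha> x)))}"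

definition cocycle_triples ::
    "('k::field \<Rightarrow> 'a::ab_group_add \<Rightarrow> 'a) \<Rightarrow> ('a \<Rightarrow> 'a \<Rightarrow> 'a) \<Rightarrow>
     ('k \<Rightarrow> 'b::ab_group_add \<Rightarrow> 'b) \<Rightarrow> ('a \<Rightarrow> 'b \<Rightarrow> 'b) \<Rightarrow>
     ('a set \<times> 'b set \<times> ('a \<Rightarrow> 'b set)) set" where
  "cocycle_triples s1 br1 s2 \<psi> =
     {(h1, U, \<alpha>). h1 \<in> lie_subalgebras s1 br1 \<and> U \<in> submodules s2 \<psi> h1 \<and>
        \<alpha> \<in> one_cocycles s1 br1 s2 \<psi> h1 U}"

definition Gamma ::
    "('a::zero \<times> 'b) set \<Rightarrow> 'a set \<times> 'b set \<times> ('a \<Rightarrow> 'b set)" where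
  "Gamma h = (fst ` h, {v. (0, v) \<in> h}, \<lambda>x\<in>fst ` h. {v. (x, v) \<in> h})"

definition Gamma_inv ::
    "'a set \<times> 'b set \<times> ('a \<Rightarrow> 'b set) \<Rightarrow> ('a \<times> 'b) set" where
  "Gamma_inv = (\<lambda>(h1, U, \<alpha>). {(x, v). x \<in> h1 \<and> v \<in> \<alpha> x})"

end

theory Submission
  imports Defs
begin

text \<open>The fibre of a subalgebra \<open>h\<close> over \<open>x\<close> is a coset of \<open>U\<close>, because two elements of \<open>h\<close> with the
  same first component differ by an element of \<open>U\<close>. Hence all operations in the quotient can be computed
  on representatives \<open>v\<close> with \<open>(x, v) \<in> h\<close>, and closure of \<open>h\<close> under sum, scaling and bracket
  translates into additivity, homogeneity and the cocycle identity of \<open>\<alpha>\<close>. Bracketing with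
  \<open>(0, u)\<close> shows that \<open>U\<close> is a submodule. Conversely \<open>\<alpha> 0 = U\<close> by homogeneity, so that \<open>U\<close> is recovered
  from \<open>\<alpha>\<close>.\<close>

text \<open>Write \<open>v = w + u\<close> with \<open>u\<close> in \<open>U\<close>. Translation by
  \<open>u\<close> or by \<open>- u\<close> maps \<open>U\<close> into itself, so both points
  represent the same coset.\<close>

lemma (in module) coset_eq:
  assumes "subspace U" and "A \<in> cosets U" and "v \<in> A"
  shows "A = v +o U"
proof -
  obtain w where w: "A = w +o U"
    using assms(2) by (auto simp: cosets_def)
  then obtain u where u: "u \<in> U" "v = w + u"
    using assms(3) by (auto simp: elt_set_plus_def)
  have "w + u' \<in> v +o U" if "u' \<in> U" for u'
    using that u subspace_diff[OF assms(1) that u(1)] by (force simp: elt_set_plus_def)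
  moreover have "v + u' \<in> w +o U" if "u' \<in> U" for u'
    using that u subspace_add[OF assms(1) u(1) that] by (force simp: elt_set_plus_def add.assoc)
  ultimately show ?thesis
    unfolding w by (auto simp: elt_set_plus_def)
qed

lemma (in module) coset_nonempty:
  assumes "subspace U" and "A \<in> cosets U"
  obtains v where "v \<in> A"
  using assms subspace_0 by (fastforce simp: cosets_def elt_set_plus_def)

lemma coset_map_memI:
  assumes "0 \<in> U" and "v \<in> A"
  shows "f v \<in> coset_map U f A"
  using set_plus_intro[of "f v" "f ` A" 0 U] assms by (simp add: coset_map_def)

lemma coset_diff_memI: "a \<in> A \<Longrightarrow> b \<in> B \<Longrightarrow> a - b \<in> coset_diff A B"
  by (auto simp: coset_diff_def)

text \<open>Over an abelian g2 every linear endomorphism is a derivation, so \<psi> amounts to a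
  representation of g1 on the vector space g2. The axioms state this pointwise.\<close>

locale lie_representation = L: lie_algebra s1 br1 + V: vector_space s2
  for s1 :: "'k::field \<Rightarrow> 'a::ab_group_add \<Rightarrow> 'a" and br1
    and s2 :: "'k \<Rightarrow> 'b::ab_group_add \<Rightarrow> 'b" +
  fixes \<psi> :: "'a \<Rightarrow> 'b \<Rightarrow> 'b"
  assumes act_add: "\<psi> x (v + w) = \<psi> x v + \<psi> x w"
    and act_scale: "\<psi> x (s2 c v) = s2 c (\<psi> x v)"
    and add_act: "\<psi> (x + y) v = \<psi> x v + \<psi> y v"
    and scale_act: "\<psi> (s1 c x) v = s2 c (\<psi> x v)"
    and bracket_act: "\<psi> (br1 x y) v = \<psi> x (\<psi> y v) - \<psi> y (\<psi> x v)"
begin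

sublocale P: vector_space_prod s1 s2
  by unfold_locales

abbreviation "semidirect_subalgebras \<equiv>
  lie_subalgebras (module_prod.scale s1 s2) (semidirect_bracket br1 \<psi>)"

lemma zero_act [simp]: "\<psi> 0 v = 0"
  using add_act[of 0 0 v] by simp

lemma bracket_zero [simp]: "br1 x 0 = 0"
  using L.linear_bracket_right[of x] L.scale_zero_left
  by (metis Vector_Spaces.linear_iff)

lemma semidirect_subalgebras_iff:
  "h \<in> semidirect_subalgebras \<longleftrightarrow>
     (0, 0) \<in> h \<and>
     (\<forall>x v y w. (x, v) \<in> h \<longrightarrow> (y, w) \<in> h \<longrightarrow> (x + y, v + w) \<in> h) \<and>
     (\<forall>c x v. (x, v) \<in> h \<longrightarrow> (s1 c x, s2 c v) \<in> h) \<and>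
     (\<forall>x v y w. (x, v) \<in> h \<longrightarrow> (y, w) \<in> h \<longrightarrow> (br1 x y, \<psi> x w - \<psi> y v) \<in> h)"
  unfolding lie_subalgebras_def P.p.subspace_def semidirect_bracket_def P.scale_def
  by (simp add: zero_prod_def Ball_def split_paired_All)

context
  fixes h
  assumes h: "h \<in> semidirect_subalgebras"
begin

lemma zero_mem: "(0, 0) \<in> h"
  and add_mem: "(x, v) \<in> h \<Longrightarrow> (y, w) \<in> h \<Longrightarrow> (x + y, v + w) \<in> h"
  and scale_mem: "(x, v) \<in> h \<Longrightarrow> (s1 c x, s2 c v) \<in> h"
  and bracket_mem: "(x, v) \<in> h \<Longrightarrow> (y, w) \<in> h \<Longrightarrow> (br1 x y, \<psi> x w - \<psi> y v) \<in> h"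
  using h unfolding semidirect_subalgebras_iff by blast+

lemma projection_subalgebra: "fst ` h \<in> lie_subalgebras s1 br1"
  unfolding lie_subalgebras_def L.subspace_def
  by (auto intro: image_eqI[OF _ zero_mem] image_eqI[OF _ add_mem] image_eqI[OF _ scale_mem]
      image_eqI[OF _ bracket_mem])

lemma kernel_submodule: "{v. (0, v) \<in> h} \<in> submodules s2 \<psi> (fst ` h)"
proof -
  \<comment> \<open>Since \<open>br1 x 0 = 0\<close> and \<open>\<psi> 0 v = 0\<close>, the lift
    \<open>v\<close> of \<open>x\<close> drops out of the bracket with
    \<open>(0, u)\<close>.\<close>
  have "\<psi> x u \<in> {v. (0, v) \<in> h}" if "(x, v) \<in> h" "(0, u) \<in> h" for x u v
    using bracket_mem[OF that] by simp
  then show ?thesis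
    using zero_mem add_mem[of 0 _ 0] scale_mem[of 0]
    by (auto simp: submodules_def V.subspace_def)
qed

lemma kernel_subspace: "V.subspace {v. (0, v) \<in> h}"
  using kernel_submodule by (simp add: submodules_def)

lemma fibre_coset:
  assumes "(x, v) \<in> h"
  shows "{w. (x, w) \<in> h} = v +o {u. (0, u) \<in> h}"
proof -
  \<comment> \<open>Scaling \<open>(x, v)\<close> by -1 and adding \<open>(x, w)\<close> cancels the
    first component and leaves \<open>(0, w - v)\<close>.\<close>
  have "\<exists>u. (0, u) \<in> h \<and> w = v + u" if "(x, w) \<in> h" for w
    using add_mem[OF that scale_mem[OF assms, of "- 1"]] by (intro exI[of _ "w - v"]) simp
  moreover have "(x, v + u) \<in> h" if "(0, u) \<in> h" for u
    using add_mem[OF assms that] by simp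
  ultimately show ?thesis
    by (auto simp: elt_set_plus_def)
qed

lemma fibre_cocycle:
  "(\<lambda>x\<in>fst ` h. {v. (x, v) \<in> h}) \<in> one_cocycles s1 br1 s2 \<psi> (fst ` h) {v. (0, v) \<in> h}"
    (is "?\<alpha> \<in> one_cocycles _ _ _ _ ?h1 ?U")
proof -
  define \<alpha> where "\<alpha> = ?\<alpha>"
  have rep: "\<alpha> x = v +o ?U" if "(x, v) \<in> h" for x v
    using fibre_coset[OF that] that by (auto simp: \<alpha>_def intro: rev_image_eqI)
  \<comment> \<open>By \<open>kernel_submodule\<close>, \<psi> x preserves \<open>?U\<close> for
    \<open>x\<close> in the projection, so the induced map can be evaluated on a
    representative.\<close>
  have act: "coset_map ?U (\<psi> x) (w +o ?U) = \<psi> x w +o ?U" if "x \<in> ?h1" for x w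
    using kernel_submodule that act_add
    by (intro V.coset_map_coset kernel_subspace) (auto simp: submodules_def)
  have scale: "coset_map ?U (s2 c) (v +o ?U) = s2 c v +o ?U" for c v
    using V.subspace_scale[OF kernel_subspace]
    by (intro V.coset_map_coset kernel_subspace) (auto simp: V.scale_right_distrib)
  have "\<alpha> \<in> ?h1 \<rightarrow>\<^sub>E cosets ?U"
    using fibre_coset by (auto simp: \<alpha>_def cosets_def)
  \<comment> \<open>Closure of \<open>h\<close> places \<open>v + w\<close> over
    \<open>x + y\<close>, so \<open>rep\<close> turns both sides into cosets of explicit
    representatives. Scaling and bracket follow the same pattern.\<close>
  moreover have "\<alpha> (x + y) = \<alpha> x + \<alpha> y" if "(x, v) \<in> h" "(y, w) \<in> h" for x v y w
    unfolding rep[OF that(1)] rep[OF that(2)] rep[OF add_mem[OF that]]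
    by (rule V.coset_plus_coset[OF kernel_subspace, symmetric])
  moreover have "\<alpha> (s1 c x) = coset_map ?U (s2 c) (\<alpha> x)" if "(x, v) \<in> h" for c x v
    unfolding rep[OF that] rep[OF scale_mem[OF that]] by (rule scale[symmetric])
  moreover have "\<alpha> (br1 x y) =
      coset_diff (coset_map ?U (\<psi> x) (\<alpha> y)) (coset_map ?U (\<psi> y) (\<alpha> x))"
    if "(x, v) \<in> h" "(y, w) \<in> h" for x v y w
  proof -
    have xy: "x \<in> ?h1" "y \<in> ?h1"
      using that by (auto intro: rev_image_eqI)
    show ?thesis
      unfolding rep[OF that(1)] rep[OF that(2)] rep[OF bracket_mem[OF that]] act[OF xy(1)] act[OF xy(2)]
      by (rule V.coset_diff_coset[OF kernel_subspace, symmetric])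
  qed
  ultimately show ?thesis
    unfolding one_cocycles_def \<alpha>_def[symmetric] by auto
qed

lemma Gamma_in_cocycle_triples: "Gamma h \<in> cocycle_triples s1 br1 s2 \<psi>"
  using projection_subalgebra kernel_submodule fibre_cocycle
  by (simp add: Gamma_def cocycle_triples_def)

end

text \<open>This is purely set-theoretic: a set of pairs is the union of its fibres over its first
  projection.\<close>

lemma Gamma_inv_Gamma: "Gamma_inv (Gamma h) = h"
proof -
  have "x \<in> fst ` h" if "(x, v) \<in> h" for x v
    using that by (rule rev_image_eqI) simp
  then show ?thesis
    unfolding Gamma_def Gamma_inv_def by auto
qed

context
  fixes h1 U \<alpha>
  assumes t: "(h1, U, \<alpha>) \<in> cocycle_triples s1 br1 s2 \<psi>"
begin

lemma domain_subspace: "L.subspace h1"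
  and domain_bracket: "x \<in> h1 \<Longrightarrow> y \<in> h1 \<Longrightarrow> br1 x y \<in> h1"
  and submodule_subspace: "V.subspace U"
  and cocycle_coset: "x \<in> h1 \<Longrightarrow> \<alpha> x \<in> cosets U"
  and cocycle_extensional: "\<alpha> \<in> extensional h1"
  and cocycle_add: "x \<in> h1 \<Longrightarrow> y \<in> h1 \<Longrightarrow> \<alpha> (x + y) = \<alpha> x + \<alpha> y"
  and cocycle_scale: "x \<in> h1 \<Longrightarrow> \<alpha> (s1 c x) = coset_map U (s2 c) (\<alpha> x)"
  and cocycle_bracket: "x \<in> h1 \<Longrightarrow> y \<in> h1 \<Longrightarrow>
    \<alpha> (br1 x y) = coset_diff (coset_map U (\<psi> x) (\<alpha> y)) (coset_map U (\<psi> y) (\<alpha> x))"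
  using t by (auto simp: cocycle_triples_def lie_subalgebras_def submodules_def one_cocycles_def
      PiE_iff)

lemma cocycle_nonempty:
  assumes "x \<in> h1"
  obtains v where "v \<in> \<alpha> x"
  using V.coset_nonempty[OF submodule_subspace cocycle_coset[OF assms]] .

lemma cocycle_scale_mem: "x \<in> h1 \<Longrightarrow> v \<in> \<alpha> x \<Longrightarrow> s2 c v \<in> \<alpha> (s1 c x)"
  unfolding cocycle_scale by (intro coset_map_memI V.subspace_0 submodule_subspace)

lemma cocycle_zero: "\<alpha> 0 = U"
proof -
  have 0: "0 \<in> h1"
    using L.subspace_0[OF domain_subspace] .
  then obtain v where "v \<in> \<alpha> 0"
    by (rule cocycle_nonempty)
  \<comment> \<open>Scaling an arbitrary element \<open>v\<close> of the fibre by 0 gives 0, which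
    lies over \<open>s1 0 0 = 0\<close>. A coset containing 0 is \<open>U\<close> itself.\<close>
  then have "0 \<in> \<alpha> 0"
    using cocycle_scale_mem[OF 0, of v 0] by simp
  then show ?thesis
    using V.coset_eq[OF submodule_subspace cocycle_coset[OF 0], of 0] by simp
qed

lemma Gamma_inv_in_semidirect_subalgebras: "Gamma_inv (h1, U, \<alpha>) \<in> semidirect_subalgebras"
proof -
  \<comment> \<open>The cocycle identity presents the fibre over the bracket as a difference of
    cosets, with \<open>\<psi> x w\<close> and \<open>\<psi> y v\<close> in the respective terms;
    \<open>0\<close> in \<open>U\<close> gives these memberships.\<close>
  have "\<psi> x w - \<psi> y v \<in> \<alpha> (br1 x y)" if "x \<in> h1" "v \<in> \<alpha> x" "y \<in> h1" "w \<in> \<alpha> y" for x v y w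
    unfolding cocycle_bracket[OF that(1,3)] using that V.subspace_0[OF submodule_subspace]
    by (intro coset_diff_memI coset_map_memI)
  then show ?thesis
    unfolding semidirect_subalgebras_iff Gamma_inv_def
    using domain_subspace submodule_subspace
    by (auto simp: cocycle_zero cocycle_add cocycle_scale_mem domain_bracket
        L.subspace_0 L.subspace_add L.subspace_scale V.subspace_0)
qed

lemma Gamma_Gamma_inv: "Gamma (Gamma_inv (h1, U, \<alpha>)) = (h1, U, \<alpha>)"
proof -
  \<comment> \<open>Cosets are nonempty, so every \<open>x\<close> in \<open>h1\<close> has a
    lift.\<close>
  have "fst ` Gamma_inv (h1, U, \<alpha>) = h1"
    proof safe
    fix x assume "x \<in> h1"
    then obtain v where "v \<in> \<alpha> x"
      by (rule cocycle_nonempty)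
    with \<open>x \<in> h1\<close> show "x \<in> fst ` Gamma_inv (h1, U, \<alpha>)"
      by (intro image_eqI[of _ _ "(x, v)"]) (simp_all add: Gamma_inv_def)
  qed (simp add: Gamma_inv_def)
  moreover have "{v. (0, v) \<in> Gamma_inv (h1, U, \<alpha>)} = U"
    using L.subspace_0[OF domain_subspace] by (simp add: Gamma_inv_def cocycle_zero)
  \<comment> \<open>Outside \<open>h1\<close> both sides are \<open>undefined\<close>, by
    extensionality of \<alpha>.\<close>
  moreover have "(\<lambda>x\<in>h1. {v. (x, v) \<in> Gamma_inv (h1, U, \<alpha>)}) = \<alpha>"
    using cocycle_extensional by (auto simp: Gamma_inv_def fun_eq_iff extensional_def)
  ultimately show ?thesis
    by (simp add: Gamma_def)
qed

end

end

theorem proposition7: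
  fixes s1 :: "'k::real_normed_field \<Rightarrow> 'a::ab_group_add \<Rightarrow> 'a"
    and s2 :: "'k \<Rightarrow> 'b::ab_group_add \<Rightarrow> 'b"
    and br1 :: "'a \<Rightarrow> 'a \<Rightarrow> 'a"
    and br2 :: "'b \<Rightarrow> 'b \<Rightarrow> 'b"
    and \<psi> :: "'a \<Rightarrow> 'b \<Rightarrow> 'b"
    and B1 :: "'a set" and B2 :: "'b set"
  assumes "finite_dimensional_vector_space s1 B1" and "lie_algebra s1 br1"
    and "finite_dimensional_vector_space s2 B2" and "lie_algebra s2 br2"
    and "abelian_bracket br2"
    and "lie_hom_to_derivations s1 br1 s2 br2 \<psi>"
  shows "Gamma \<in> lie_subalgebras (module_prod.scale s1 s2) (semidirect_bracket br1 \<psi>)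
          \<rightarrow> cocycle_triples s1 br1 s2 \<psi> \<and>
    Gamma_inv \<in> cocycle_triples s1 br1 s2 \<psi>
          \<rightarrow> lie_subalgebras (module_prod.scale s1 s2) (semidirect_bracket br1 \<psi>) \<and>
    (\<forall>h\<in>lie_subalgebras (module_prod.scale s1 s2) (semidirect_bracket br1 \<psi>).
        Gamma_inv (Gamma h) = h) \<and>
    (\<forall>t\<in>cocycle_triples s1 br1 s2 \<psi>. Gamma (Gamma_inv t) = t)"
proof -
  interpret L1: lie_algebra s1 br1 by fact
  interpret L2: lie_algebra s2 br2 by fact
  have hom: "module_hom s2 s2 (\<psi> x)" for x
    using assms(6) by (simp add: lie_hom_to_derivations_def derivations_def module_hom_iff_linear)
  \<comment> \<open>Linearity of each \<psi> x comes from its being a derivation; the axioms in the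
    g1 argument are the homomorphism property evaluated at a vector.\<close>
  interpret lie_representation s1 br1 s2 \<psi>
    using assms(6) module_hom.add[OF hom] module_hom.scale[OF hom]
    by unfold_locales (simp_all add: lie_hom_to_derivations_def)
  show ?thesis
    using Gamma_in_cocycle_triples Gamma_inv_Gamma Gamma_inv_in_semidirect_subalgebras
      Gamma_Gamma_inv
    by (auto simp del: split_paired_All)
qed

end
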